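(* Let $\mathbb K$ be an algebraically closed field of characteristic zero, let $\mathcal C\subset\mathbb K^2$ be an irreducible conic, let $A\in\mathcal C$ and let $d\in\mathbb K\setminus\{0\}$. Then the conchoid $\mathfrak C(\mathcal C)$ of $\mathcal C$ from the focus $A$ and distance $d$ is rational.
   Context: An irreducible conic is an affine plane curve defined by an irreducible polynomial $f\in\mathbb K[y_1,y_2]$ of degree 2. For $P=(P_1,P_2)$ write $\|P\|^2=P_1^2+P_2^2$ (no conjugation). The conchoid $\mathfrak C(\mathcal C)$ is the Zariski closure in $\mathbb K^2$ of the set of points $\bar x\in\mathbb K^2$ for which there exist $\bar y\in\mathbb K^2$ and $\lambda\in\mathbb K$ with $f(\bar y)=0$, $\|\bar x-\bar y\|^2=d^2$ and $\bar x=A+\lambda(\bar y-A)$. A plane curve is rational if it is irreducible and there is a pair of rational functions in $\mathbb K(t)^2$, not both constant, whose values are Zariski dense in the curve. *)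

theory Defs
  imports "HOL-Computational_Algebra.Computational_Algebra" "HOL-Library.Product_Plus"
begin

(* A polynomial in K[y1,y2] is an element f of K[y1][y2], type 'a poly poly:
   the coefficient of y1^i y2^j is coeff (coeff f j) i. *)

definition eval2 :: "'a::comm_ring_1 poly poly \<Rightarrow> 'a \<times> 'a \<Rightarrow> 'a" where
  "eval2 f P = poly (poly f [:snd P:]) (fst P)"

(* 0 is inserted only to give the zero polynomial a value, namely 0. *)
definition total_degree :: "'a::zero poly poly \<Rightarrow> nat" where
  "total_degree f = Max (insert 0 {i + j |i j. coeff (coeff f j) i \<noteq> 0})"

definition zero_set :: "'a::comm_ring_1 poly poly \<Rightarrow> ('a \<times> 'a) set" where
  "zero_set f = {P. eval2 f P = 0}"

definition zariski_closed :: "('a::comm_ring_1 \<times> 'a) set \<Rightarrow> bool" where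
  "zariski_closed X \<longleftrightarrow> (\<exists>F. X = {P. \<forall>f\<in>F. eval2 f P = 0})"

definition zariski_closure :: "('a::comm_ring_1 \<times> 'a) set \<Rightarrow> ('a \<times> 'a) set" where
  "zariski_closure S = zariski_closed hull S"

definition zariski_irreducible :: "('a::comm_ring_1 \<times> 'a) set \<Rightarrow> bool" where
  "zariski_irreducible X \<longleftrightarrow> zariski_closed X \<and> X \<noteq> {} \<and>
     (\<forall>Y Z. zariski_closed Y \<longrightarrow> zariski_closed Z \<longrightarrow> X = Y \<union> Z \<longrightarrow> X = Y \<or> X = Z)"

definition plane_curve :: "('a::comm_ring_1 \<times> 'a) set \<Rightarrow> bool" where
  "plane_curve X \<longleftrightarrow> (\<exists>f. 0 < total_degree f \<and> X = zero_set f)"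

(* Irreducibility is over the ring 'a poly poly, so constants are excluded as units. *)
definition irreducible_conic :: "('a::field \<times> 'a) set \<Rightarrow> bool" where
  "irreducible_conic C \<longleftrightarrow> (\<exists>f. irreducible f \<and> total_degree f = 2 \<and> C = zero_set f)"

definition sq_norm :: "'a::comm_ring_1 \<times> 'a \<Rightarrow> 'a" where
  "sq_norm P = (fst P)\<^sup>2 + (snd P)\<^sup>2"

definition conchoid :: "('a::comm_ring_1 \<times> 'a) set \<Rightarrow> 'a \<times> 'a \<Rightarrow> 'a \<Rightarrow> ('a \<times> 'a) set" where
  "conchoid C A d = zariski_closure {x. \<exists>y l. y \<in> C \<and> sq_norm (x - y) = d\<^sup>2 \<and>
     x = (fst A + l * (fst y - fst A), snd A + l * (snd y - snd A))}"

(* The rational function r is defined at t, with value v: some representation of r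
   (not necessarily a given one) has a denominator that does not vanish at t. *)
definition ratfun_value :: "'a::field poly fract \<Rightarrow> 'a \<Rightarrow> 'a \<Rightarrow> bool" where
  "ratfun_value r t v \<longleftrightarrow>
     (\<exists>p q. r = Fract p q \<and> poly q t \<noteq> 0 \<and> v = poly p t / poly q t)"

definition ratfun_constant :: "'a::field poly fract \<Rightarrow> bool" where
  "ratfun_constant r \<longleftrightarrow> (\<exists>c. r = to_fract [:c:])"

(* The closure condition says that the values of the pair (r, s), taken where both
   components are defined, lie on X and are dense in it. *)
definition rational_curve :: "('a::field \<times> 'a) set \<Rightarrow> bool" where
  "rational_curve X \<longleftrightarrow> plane_curve X \<and> zariski_irreducible X \<and>
     (\<exists>r s. \<not> (ratfun_constant r \<and> ratfun_constant s) \<and>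
        zariski_closure {(u, v) |u v. \<exists>t. ratfun_value r t u \<and> ratfun_value s t v} = X)"

end

theory Submission
  imports Defs
begin

text \<open>
  Let \<open>f\<close> be an equation of the conic. Since \<open>A\<close> lies on it, \<open>f (A + m v) = m L v + m\<^sup>2 Q v\<close> with a
  linear form \<open>L\<close> and a quadratic form \<open>Q\<close>. They have no common zero \<open>v \<noteq> 0\<close>, for otherwise the conic
  would contain a line and its equation would be reducible. So a line through \<open>A\<close> with direction \<open>v\<close>
  meets the conic in at most one other point, \<open>A - (L v / Q v) v\<close>.

  If \<open>v\<close> is a unit vector, the points at distance \<open>d\<close> from that point on the line are
  \<open>A + (\<plusminus> d - L v / Q v) v\<close>. The two signs are exchanged by \<open>v \<mapsto> - v\<close>, which leaves the line and the
  point of the conic unchanged. Hence one formula, \<open>v \<mapsto> A + (d - L v / Q v) v\<close>, gives all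
  points whose closure is the conchoid, with \<open>v\<close> running over the unit circle. This is where
  \<open>A \<in> C\<close> matters: the square root that separates the two signs disappears. The unit circle is itself
  parametrized by \<open>v = ((t + 1/t) / 2, (t - 1/t) / (2 \<iota>))\<close> with \<open>\<iota>\<^sup>2 = - 1\<close>, so the conchoid is the
  closure of the image of a pair of rational functions of \<open>t\<close>.

  It remains to see that such a closure is an irreducible plane curve
  (lemma \<open>rational_curve_closure\<close>). Irreducibility holds because a polynomial in the coordinates,
  evaluated along the parametrization, becomes a rational function of \<open>t\<close>, which
  vanishes identically or at finitely many \<open>t\<close>. That the closure is the zero set of a single polynomial
  needs two facts. The first coordinate is not constant: its values at \<open>t\<close> and \<open>- t\<close> differ
  by \<open>2 d v\<^sub>1\<close>. The coordinates are algebraically dependent: for \<open>z = x - A\<close>, elimination of \<open>v\<close> gives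
  \<open>(z\<^sub>1\<^sup>2 + z\<^sub>2\<^sup>2) f(x)\<^sup>2 = d\<^sup>2 Q(z)\<^sup>2\<close>. The zero set of this relation may be larger than the
  conchoid, so the equation of the conchoid is found abstractly, as a generator of the prime ideal
  of all relations (lemma \<open>principal\<close>).
\<close>

section \<open>Polynomials in two variables and the Zariski topology\<close>

lemma eval2_simps [simp]:
  "eval2 0 P = 0"
  "eval2 (pCons a g) P = poly a (fst P) + snd P * eval2 g P"
  "eval2 (g + h) P = eval2 g P + eval2 h P"
  "eval2 (g - h) P = eval2 g P - eval2 h P"
  "eval2 (g * h) P = eval2 g P * eval2 h P"
  "eval2 (smult a g) P = poly a (fst P) * eval2 g P"
  "eval2 (g ^ n) P = eval2 g P ^ n"
  by (simp_all add: eval2_def)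

lemma zariski_closure_iff:
  "P \<in> zariski_closure S \<longleftrightarrow> (\<forall>g. (\<forall>Q\<in>S. eval2 g Q = 0) \<longrightarrow> eval2 g P = 0)"
proof -
  let ?X = "{P. \<forall>g\<in>{g. \<forall>Q\<in>S. eval2 g Q = 0}. eval2 g P = 0}"
  have "zariski_closed hull S = ?X"
  proof (rule hull_unique)
    show "S \<subseteq> ?X" by blast
    show "zariski_closed ?X" unfolding zariski_closed_def by blast
    show "?X \<subseteq> Y" if "S \<subseteq> Y" "zariski_closed Y" for Y
      using that unfolding zariski_closed_def by blast
  qed
  then show ?thesis unfolding zariski_closure_def by auto
qed

lemma zariski_closed_zariski_closure: "zariski_closed (zariski_closure S)"
proof -
  have "zariski_closure S = {P. \<forall>g\<in>{g. \<forall>Q\<in>S. eval2 g Q = 0}. eval2 g P = 0}"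
    by (auto simp: zariski_closure_iff)
  then show ?thesis unfolding zariski_closed_def by blast
qed

lemma subset_zariski_closure: "S \<subseteq> zariski_closure S"
  by (auto simp: zariski_closure_iff)

lemma zariski_closure_minimal:
  assumes "S \<subseteq> Y" and "zariski_closed Y"
  shows "zariski_closure S \<subseteq> Y"
  using assms unfolding zariski_closure_def by (simp add: hull_minimal)

lemma finite_total_degree_indices:
  fixes f :: "'a::zero poly poly"
  shows "finite {i + j |i j. coeff (coeff f j) i \<noteq> 0}"
proof -
  have "{i + j |i j. coeff (coeff f j) i \<noteq> 0}
      \<subseteq> (\<lambda>(i, j). i + j) ` (\<Union>j\<in>{..degree f}. (\<lambda>i. (i, j)) ` {..degree (coeff f j)})"
  proof
    fix n assume "n \<in> {i + j |i j. coeff (coeff f j) i \<noteq> 0}"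
    then obtain i j where ij: "n = i + j" "coeff (coeff f j) i \<noteq> 0" by blast
    from ij have "coeff f j \<noteq> 0" by auto
    then have "j \<le> degree f" "i \<le> degree (coeff f j)"
      using ij by (auto intro: le_degree)
    then show "n \<in> (\<lambda>(i, j). i + j) ` (\<Union>j\<in>{..degree f}. (\<lambda>i. (i, j)) ` {..degree (coeff f j)})"
      using ij by force
  qed
  then show ?thesis by (rule finite_subset) auto
qed

lemma coeff_le_total_degree:
  assumes "coeff (coeff f j) i \<noteq> 0"
  shows "i + j \<le> total_degree f"
  unfolding total_degree_def
  using assms finite_total_degree_indices[of f] by (intro Max_ge) auto

lemma degree_le_total_degree: "degree f \<le> total_degree f"
proof (cases "f = 0")
  case False
  then have "coeff (coeff f (degree f)) (degree (coeff f (degree f))) \<noteq> 0" by simp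
  from coeff_le_total_degree[OF this] show ?thesis by simp
qed simp

lemma total_degree_attained:
  assumes "total_degree f > 0"
  obtains i j where "i + j = total_degree f" "coeff (coeff f j) i \<noteq> 0"
proof -
  let ?N = "{i + j |i j. coeff (coeff f j) i \<noteq> 0}"
  have "total_degree f \<in> insert 0 ?N"
    unfolding total_degree_def by (intro Max_in) (use finite_total_degree_indices[of f] in auto)
  then have "total_degree f \<in> ?N" using assms by (simp only: insert_iff) simp
  then obtain i j where "total_degree f = i + j" "coeff (coeff f j) i \<noteq> 0" by blast
  then show ?thesis by (intro that[of i j]) auto
qed

section \<open>Evaluation at pairs of rational functions\<close>

definition ratpoint :: "'a::field poly \<Rightarrow> 'a poly \<Rightarrow> 'a poly \<Rightarrow> 'a \<Rightarrow> 'a \<times> 'a" where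
  "ratpoint N1 N2 D t = (poly N1 t / poly D t, poly N2 t / poly D t)"

lemma poly_clear_denominators:
  fixes a N D :: "'a::field poly"
  shows "\<exists>h n. \<forall>t. poly D t \<noteq> 0 \<longrightarrow> poly h t = poly D t ^ n * poly a (poly N t / poly D t)"
proof (induction a)
  case 0
  show ?case by (rule exI[of _ 0]) simp
next
  case (pCons c a)
  then obtain h n where h: "\<And>t. poly D t \<noteq> 0 \<Longrightarrow>
    poly h t = poly D t ^ n * poly a (poly N t / poly D t)" by blast
  show ?case
    by (rule exI[of _ "smult c (D ^ Suc n) + N * h"], rule exI[of _ "Suc n"])
      (simp add: h field_simps)
qed

lemma eval2_clear_denominators:
  fixes N1 N2 D :: "'a::field poly"
  shows "\<exists>h n. \<forall>t. poly D t \<noteq> 0 \<longrightarrow> poly h t = poly D t ^ n * eval2 g (ratpoint N1 N2 D t)"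
proof (induction g)
  case 0
  show ?case by (rule exI[of _ 0]) simp
next
  case (pCons a g)
  then obtain h n where h: "\<And>t. poly D t \<noteq> 0 \<Longrightarrow>
    poly h t = poly D t ^ n * eval2 g (ratpoint N1 N2 D t)" by blast
  obtain k m where k: "\<And>t. poly D t \<noteq> 0 \<Longrightarrow>
    poly k t = poly D t ^ m * poly a (poly N1 t / poly D t)"
    using poly_clear_denominators by blast
  show ?case
    by (rule exI[of _ "D ^ Suc n * k + D ^ m * N2 * h"], rule exI[of _ "Suc n + m"])
      (simp add: h k ratpoint_def field_simps power_add)
qed

text \<open>After clearing denominators the value is a polynomial in the parameter, and infinitely many
  zeros force it to be zero.\<close>

lemma eval2_ratpoint_eq_0:
  fixes N1 N2 D :: "'a::field poly"
  assumes inf: "infinite {t. poly D t \<noteq> 0 \<and> eval2 g (ratpoint N1 N2 D t) = 0}"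
    and t: "poly D t \<noteq> 0"
  shows "eval2 g (ratpoint N1 N2 D t) = 0"
proof -
  obtain h n where h: "\<And>t. poly D t \<noteq> 0 \<Longrightarrow>
    poly h t = poly D t ^ n * eval2 g (ratpoint N1 N2 D t)"
    using eval2_clear_denominators by blast
  have "{t. poly D t \<noteq> 0 \<and> eval2 g (ratpoint N1 N2 D t) = 0} \<subseteq> {t. poly h t = 0}"
    using h by auto
  then have "infinite {t. poly h t = 0}" using inf infinite_super by blast
  then have "h = 0" using poly_roots_finite by blast
  then show ?thesis using h[OF t] t by simp
qed

lemma infinite_nonroots:
  fixes E :: "'a::field_char_0 poly"
  assumes "E \<noteq> 0"
  shows "infinite {t. poly E t \<noteq> 0}"
proof -
  have "infinite (UNIV - {t. poly E t = 0})"
    using poly_roots_finite[OF assms] infinite_UNIV_char_0 by (rule Diff_infinite_finite)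
  moreover have "UNIV - {t. poly E t = 0} = {t. poly E t \<noteq> 0}" by auto
  ultimately show ?thesis by simp
qed

text \<open>A rational function may be defined at a zero of a given denominator. Its value there comes from
  another representation, which agrees with the given one wherever both make sense.\<close>

lemma ratfun_value_Fract:
  assumes v: "ratfun_value (Fract N D) t v" and D: "D \<noteq> 0"
  shows "\<exists>p q. poly q t \<noteq> 0 \<and> v = poly p t / poly q t \<and>
    (\<forall>s. poly q s \<noteq> 0 \<longrightarrow> poly D s \<noteq> 0 \<longrightarrow> poly p s / poly q s = poly N s / poly D s)"
proof -
  obtain p q where pq: "Fract N D = Fract p q" "poly q t \<noteq> 0" "v = poly p t / poly q t"
    using v unfolding ratfun_value_def by blast
  have "q \<noteq> 0" using pq by auto
  then have "N * q = p * D" using pq D by (simp add: eq_fract)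
  then have e: "poly N s * poly q s = poly p s * poly D s" for s by (metis poly_mult)
  have "poly p s / poly q s = poly N s / poly D s" if "poly q s \<noteq> 0" "poly D s \<noteq> 0" for s
    using e[of s] that by (simp add: field_simps)
  then show ?thesis using pq(2,3) by blast
qed

section \<open>The closure of a rationally parametrized set of points\<close>

text \<open>The polynomial \<open>E\<close> selects the parameters that are used: finitely many may be left out beyond
  the zeros of the denominator, which does not change the closure.\<close>

locale rational_parametrization =
  fixes N1 N2 D E :: "'a::{alg_closed_field, field_char_0} poly"
  assumes D_dvd_E: "D dvd E" and E_nz: "E \<noteq> 0"
    and nonconstant: "\<And>c. N1 \<noteq> smult c D"
begin

definition "vanishes g \<longleftrightarrow> (\<forall>t. poly E t \<noteq> 0 \<longrightarrow> eval2 g (ratpoint N1 N2 D t) = 0)"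

abbreviation "param_points \<equiv> {ratpoint N1 N2 D t |t. poly E t \<noteq> 0}"

lemma D_nz: "D \<noteq> 0"
  using D_dvd_E E_nz by auto

lemma poly_D_nz: "poly E t \<noteq> 0 \<Longrightarrow> poly D t \<noteq> 0"
  using D_dvd_E by (auto elim!: dvdE)

lemma param_points_closure_iff:
  "P \<in> zariski_closure param_points \<longleftrightarrow> (\<forall>g. vanishes g \<longrightarrow> eval2 g P = 0)"
  unfolding zariski_closure_iff vanishes_def by blast

lemma vanishes_if_infinite:
  assumes "infinite {t. poly E t \<noteq> 0 \<and> eval2 g (ratpoint N1 N2 D t) = 0}"
  shows "vanishes g"
proof -
  have "{t. poly E t \<noteq> 0 \<and> eval2 g (ratpoint N1 N2 D t) = 0}
      \<subseteq> {t. poly D t \<noteq> 0 \<and> eval2 g (ratpoint N1 N2 D t) = 0}"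
    using poly_D_nz by blast
  with assms have "infinite {t. poly D t \<noteq> 0 \<and> eval2 g (ratpoint N1 N2 D t) = 0}"
    using infinite_super by blast
  then show ?thesis
    unfolding vanishes_def using eval2_ratpoint_eq_0 poly_D_nz by blast
qed

text \<open>The field is infinite, so one of two polynomials that together vanish at every parameter
  vanishes at infinitely many. This is the irreducibility of the parameter line.\<close>

lemma vanishes_cover:
  assumes "\<And>t. poly E t \<noteq> 0 \<Longrightarrow>
    eval2 g (ratpoint N1 N2 D t) = 0 \<or> eval2 h (ratpoint N1 N2 D t) = 0"
  shows "vanishes g \<or> vanishes h"
proof (rule ccontr)
  assume "\<not> (vanishes g \<or> vanishes h)"
  then have "finite {t. poly E t \<noteq> 0 \<and> eval2 g (ratpoint N1 N2 D t) = 0}"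
    "finite {t. poly E t \<noteq> 0 \<and> eval2 h (ratpoint N1 N2 D t) = 0}"
    using vanishes_if_infinite by blast+
  then have "finite ({t. poly E t \<noteq> 0 \<and> eval2 g (ratpoint N1 N2 D t) = 0}
    \<union> {t. poly E t \<noteq> 0 \<and> eval2 h (ratpoint N1 N2 D t) = 0})" by simp
  moreover have "{t. poly E t \<noteq> 0} \<subseteq> {t. poly E t \<noteq> 0 \<and> eval2 g (ratpoint N1 N2 D t) = 0}
    \<union> {t. poly E t \<noteq> 0 \<and> eval2 h (ratpoint N1 N2 D t) = 0}"
    using assms by blast
  ultimately show False using infinite_nonroots[OF E_nz] finite_subset by blast
qed

lemma vanishes_mult: "vanishes (g * h) \<longleftrightarrow> vanishes g \<or> vanishes h"
  using vanishes_cover[of g h] by (auto simp: vanishes_def)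

text \<open>A relation in the first coordinate alone would confine that coordinate to the finitely many
  roots of \<open>w\<close>, and then it would be constant.\<close>

lemma not_vanishes_const:
  assumes "w \<noteq> 0"
  shows "\<not> vanishes [:w:]"
proof
  assume "vanishes [:w:]"
  then have w: "poly w (poly N1 t / poly D t) = 0" if "poly E t \<noteq> 0" for t
    using that by (simp add: vanishes_def ratpoint_def)
  let ?r = "\<lambda>t. poly N1 t / poly D t"
  have "?r ` {t. poly E t \<noteq> 0} \<subseteq> {x. poly w x = 0}" using w by blast
  then have "finite (?r ` {t. poly E t \<noteq> 0})"
    using poly_roots_finite[OF assms] finite_subset by blast
  \<comment> \<open>By the pigeonhole principle one value is taken infinitely often.\<close>
  then obtain c where "infinite {t \<in> {t. poly E t \<noteq> 0}. ?r t = ?r c}"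
    using pigeonhole_infinite[OF infinite_nonroots[OF E_nz]] by blast
  moreover have "{t \<in> {t. poly E t \<noteq> 0}. ?r t = ?r c} \<subseteq> {t. poly (N1 - smult (?r c) D) t = 0}"
    using poly_D_nz by (auto simp: field_simps)
  ultimately have "infinite {t. poly (N1 - smult (?r c) D) t = 0}"
    using infinite_super by blast
  then have "N1 - smult (?r c) D = 0" using poly_roots_finite by blast
  then show False using nonconstant by simp
qed

lemma irreducible_closure: "zariski_irreducible (zariski_closure param_points)"
  unfolding zariski_irreducible_def
proof (intro conjI allI impI)
  show "zariski_closed (zariski_closure param_points)"
    by (rule zariski_closed_zariski_closure)
  obtain t where "poly E t \<noteq> 0"
    using infinite_imp_nonempty[OF infinite_nonroots[OF E_nz]] by blast
  then have "ratpoint N1 N2 D t \<in> param_points" by blast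
  then have "ratpoint N1 N2 D t \<in> zariski_closure param_points"
    by (rule subsetD[OF subset_zariski_closure])
  then show "zariski_closure param_points \<noteq> {}" by (intro notI) simp
next
  fix Y Z :: "('a \<times> 'a) set"
  assume Y: "zariski_closed Y" and Z: "zariski_closed Z"
    and eq: "zariski_closure param_points = Y \<union> Z"
  obtain F where F: "Y = {P. \<forall>f\<in>F. eval2 f P = 0}" using Y unfolding zariski_closed_def by blast
  obtain H where H: "Z = {P. \<forall>f\<in>H. eval2 f P = 0}" using Z unfolding zariski_closed_def by blast
  have cover: "ratpoint N1 N2 D t \<in> Y \<or> ratpoint N1 N2 D t \<in> Z" if "poly E t \<noteq> 0" for t
  proof -
    have "ratpoint N1 N2 D t \<in> zariski_closure param_points"
      by (rule subsetD[OF subset_zariski_closure]) (use that in blast)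
    then show ?thesis unfolding eq by simp
  qed
  have "(\<forall>g\<in>F. vanishes g) \<or> (\<forall>h\<in>H. vanishes h)"
  proof (rule ccontr)
    assume "\<not> ((\<forall>g\<in>F. vanishes g) \<or> (\<forall>h\<in>H. vanishes h))"
    then obtain g h where g: "g \<in> F" "\<not> vanishes g" and h: "h \<in> H" "\<not> vanishes h"
      by blast
    have "vanishes g \<or> vanishes h"
    proof (rule vanishes_cover)
      fix t assume "poly E t \<noteq> 0"
      from cover[OF this] show "eval2 g (ratpoint N1 N2 D t) = 0 \<or> eval2 h (ratpoint N1 N2 D t) = 0"
        unfolding F H using g(1) h(1) by auto
    qed
    with g h show False by simp
  qed
  then have "param_points \<subseteq> Y \<or> param_points \<subseteq> Z"
    unfolding F H vanishes_def by (elim disjE) auto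
  then have "zariski_closure param_points \<subseteq> Y \<or> zariski_closure param_points \<subseteq> Z"
    using zariski_closure_minimal[OF _ Y] zariski_closure_minimal[OF _ Z] by auto
  then show "zariski_closure param_points = Y \<or> zariski_closure param_points = Z"
    unfolding eq by auto
qed

lemma prime_elem_linear_const:
  "prime_elem ([:[:- c, 1:]:] :: 'a poly poly)"
  unfolding prime_elem_const_poly_iff by (rule prime_elem_linear_field_poly) simp

text \<open>The relations form a prime ideal that contains no nonzero polynomial in the first variable alone.
  Take a relation \<open>g\<close> of least degree in the second variable. Pseudo-division by \<open>g\<close> leaves no
  remainder, so every relation \<open>h\<close> satisfies \<open>w h = g q\<close> with \<open>w \<noteq> 0\<close> in the first variable. To remove
  \<open>w\<close>, take \<open>g\<close> with leading coefficient of least degree among the candidates: then \<open>g\<close>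
  has no linear factor \<open>x - c\<close>, since the cofactor would be a smaller relation. As \<open>w\<close> splits into
  such primes, they all divide \<open>q\<close> and can be cancelled one at a time.\<close>

lemma principal:
  assumes "G \<noteq> 0" and "vanishes G"
  obtains g where "degree g > 0" "vanishes g" "\<And>h. vanishes h \<Longrightarrow> g dvd h"
proof -
  obtain g0 where g0: "g0 \<noteq> 0 \<and> vanishes g0"
    and min0: "\<And>h. h \<noteq> 0 \<and> vanishes h \<Longrightarrow> degree g0 \<le> degree h"
    using ex_has_least_nat[of "\<lambda>g. g \<noteq> 0 \<and> vanishes g" G degree] assms by blast
  obtain g where g: "g \<noteq> 0" "vanishes g" "degree g = degree g0"
    and min: "\<And>h. h \<noteq> 0 \<and> vanishes h \<and> degree h = degree g0 \<Longrightarrow>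
      degree (lead_coeff g) \<le> degree (lead_coeff h)"
    using ex_has_least_nat[of "\<lambda>g. g \<noteq> 0 \<and> vanishes g \<and> degree g = degree g0" g0
        "\<lambda>g. degree (lead_coeff g)"] g0 by blast
  have "degree g > 0"
  proof (rule ccontr)
    assume "\<not> degree g > 0"
    then obtain w where "g = [:w:]" using degree_eq_zeroE by blast
    then show False using g not_vanishes_const by auto
  qed
  moreover have no_const: "\<not> [:[:- c, 1:]:] dvd g" for c
  proof
    assume "[:[:- c, 1:]:] dvd g"
    then obtain k where k: "g = [:[:- c, 1:]:] * k" by (elim dvdE)
    have "vanishes k" using g(2) not_vanishes_const[of "[:- c, 1:]"] unfolding k vanishes_mult by simp
    moreover have "k \<noteq> 0" using g(1) k by auto
    moreover have "degree g = degree k" using k by simp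
    ultimately have "degree (lead_coeff g) \<le> degree (lead_coeff k)" using min g(3) by simp
    moreover have "lead_coeff g = [:- c, 1:] * lead_coeff k"
      unfolding k lead_coeff_mult by simp
    then have "degree (lead_coeff g) = 1 + degree (lead_coeff k)"
      using \<open>k \<noteq> 0\<close> by (simp add: degree_mult_eq del: mult_pCons_left)
    ultimately show False by simp
  qed
  have cancel: "g dvd h" if "w \<noteq> 0" "smult w h = g * q" for w h q
    using that
  proof (induction "degree w" arbitrary: w q)
    case 0
    then obtain c where c: "w = [:c:]" "c \<noteq> 0" using degree_eq_zeroE by (metis pCons_0_0)
    have "[:inverse c:] * w = 1" using c by (simp add: one_pCons)
    then have "h = smult [:inverse c:] (smult w h)" by (simp only: smult_smult smult_1_left)
    also have "\<dots> = g * smult [:inverse c:] q" using 0 by simp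
    finally show ?case by (rule dvdI)
  next
    case (Suc n)
    then obtain x where "poly w x = 0" using alg_closed_imp_poly_has_root[of w] by auto
    then obtain u where u: "w = [:- x, 1:] * u" by (auto simp: poly_eq_0_iff_dvd elim: dvdE)
    have "u \<noteq> 0" using Suc.prems u by auto
    then have "degree w = 1 + degree u" unfolding u by (subst degree_mult_eq) auto
    then have n: "n = degree u" using Suc.hyps(2) by simp
    have "[:[:- x, 1:]:] * smult u h = smult w h" unfolding u by simp
    also have "\<dots> = g * q" by (rule Suc.prems(2))
    finally have eq: "[:[:- x, 1:]:] * smult u h = g * q" .
    then have "[:[:- x, 1:]:] dvd g * q" by (metis dvdI)
    then have "[:[:- x, 1:]:] dvd q"
      using prime_elem_dvd_multD[OF prime_elem_linear_const] no_const by blast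
    then obtain q' where q': "q = [:[:- x, 1:]:] * q'" by (elim dvdE)
    have "[:[:- x, 1:]:] * smult u h = [:[:- x, 1:]:] * (g * q')"
      using eq unfolding q' by (simp only: ac_simps)
    then have "smult u h = g * q'" by (subst (asm) mult_left_cancel) auto
    then show ?case using Suc.hyps(1)[OF n \<open>u \<noteq> 0\<close>] by blast
  qed
  have "g dvd h" if h: "vanishes h" for h
  proof -
    obtain w q where w: "w \<noteq> 0" "smult w h = g * q + pseudo_mod h g"
      using pseudo_mod(1)[OF g(1)] by blast
    have "pseudo_mod h g = smult w h - g * q" using w by simp
    then have "vanishes (pseudo_mod h g)" using h g(2) by (simp add: vanishes_def)
    then have "pseudo_mod h g = 0"
      using pseudo_mod(2)[OF g(1), of h] min0[of "pseudo_mod h g"] g(3) by fastforce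
    then show ?thesis using w cancel by simp
  qed
  ultimately show ?thesis using g(2) that by blast
qed

lemma plane_curve_closure:
  assumes "G \<noteq> 0" and "vanishes G"
  shows "plane_curve (zariski_closure param_points)"
proof -
  obtain g where g: "degree g > 0" "vanishes g" "\<And>h. vanishes h \<Longrightarrow> g dvd h"
    using principal[OF assms] by blast
  have "eval2 h P = 0" if "vanishes h" "eval2 g P = 0" for h P
    using g(3)[OF that(1)] that(2) by (auto elim: dvdE)
  then have "P \<in> zariski_closure param_points \<longleftrightarrow> P \<in> zero_set g" for P
    unfolding param_points_closure_iff zero_set_def using g(2) by blast
  then have "zariski_closure param_points = zero_set g" by blast
  moreover have "total_degree g > 0" using g(1) degree_le_total_degree[of g] by simp
  ultimately show ?thesis unfolding plane_curve_def by blast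
qed

text \<open>The values of the two fractions include points at parameters outside the chosen set, possibly
  computed from other representations. A relation that holds at almost all parameters extends to these
  by lemma \<open>eval2_ratpoint_eq_0\<close>, applied to a common denominator of the representations.\<close>

lemma values_closure:
  "zariski_closure {(u, v) |u v. \<exists>t. ratfun_value (Fract N1 D) t u \<and> ratfun_value (Fract N2 D) t v}
     = zariski_closure param_points" (is "zariski_closure ?T = _")
proof
  have "param_points \<subseteq> ?T"
    using D_nz poly_D_nz unfolding ratpoint_def ratfun_value_def by blast
  then show "zariski_closure param_points \<subseteq> zariski_closure ?T"
    by (meson order_trans subset_zariski_closure zariski_closed_zariski_closure zariski_closure_minimal)
  have "(u, v) \<in> zariski_closure param_points"
    if u: "ratfun_value (Fract N1 D) t u" and v: "ratfun_value (Fract N2 D) t v" for u v t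
  proof -
    obtain p1 q1 where 1: "poly q1 t \<noteq> 0" "u = poly p1 t / poly q1 t"
      "\<And>t. poly q1 t \<noteq> 0 \<Longrightarrow> poly D t \<noteq> 0 \<Longrightarrow> poly p1 t / poly q1 t = poly N1 t / poly D t"
      using ratfun_value_Fract[OF u D_nz] by blast
    obtain p2 q2 where 2: "poly q2 t \<noteq> 0" "v = poly p2 t / poly q2 t"
      "\<And>t. poly q2 t \<noteq> 0 \<Longrightarrow> poly D t \<noteq> 0 \<Longrightarrow> poly p2 t / poly q2 t = poly N2 t / poly D t"
      using ratfun_value_Fract[OF v D_nz] by blast
    let ?R = "ratpoint (p1 * q2) (p2 * q1) (q1 * q2)"
    have R: "?R s = (poly p1 s / poly q1 s, poly p2 s / poly q2 s)"
      if "poly (q1 * q2) s \<noteq> 0" for s using that by (simp add: ratpoint_def)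
    have "eval2 g (u, v) = 0" if g: "vanishes g" for g
    proof -
      have "E * (q1 * q2) \<noteq> 0" using 1 2 E_nz by auto
      then have "infinite {s. poly (E * (q1 * q2)) s \<noteq> 0}" by (rule infinite_nonroots)
      moreover have "{s. poly (E * (q1 * q2)) s \<noteq> 0}
          \<subseteq> {s. poly (q1 * q2) s \<noteq> 0 \<and> eval2 g (?R s) = 0}"
        using g poly_D_nz R 1(3) 2(3) by (auto simp: vanishes_def ratpoint_def)
      ultimately have "infinite {s. poly (q1 * q2) s \<noteq> 0 \<and> eval2 g (?R s) = 0}"
        using infinite_super by blast
      then have "eval2 g (?R t) = 0" by (rule eval2_ratpoint_eq_0) (use 1 2 in simp)
      then show ?thesis using R 1 2 by simp
    qed
    then show ?thesis unfolding param_points_closure_iff by blast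
  qed
  then have "?T \<subseteq> zariski_closure param_points" by blast
  then show "zariski_closure ?T \<subseteq> zariski_closure param_points"
    by (rule zariski_closure_minimal) (rule zariski_closed_zariski_closure)
qed

lemma rational_curve_closure:
  assumes "G \<noteq> 0" and "vanishes G"
  shows "rational_curve (zariski_closure param_points)"
proof -
  have "\<not> ratfun_constant (Fract N1 D)"
  proof
    assume "ratfun_constant (Fract N1 D)"
    then obtain c where "Fract N1 D = Fract [:c:] 1"
      unfolding ratfun_constant_def to_fract_def by blast
    then have "N1 = smult c D" using D_nz by (simp add: eq_fract)
    then show False using nonconstant by blast
  qed
  then show ?thesis
    unfolding rational_curve_def
    using plane_curve_closure[OF assms] irreducible_closure values_closure by blast
qed

end

section \<open>Irreducible conics\<close>

lemma poly_eq_sum_atMost: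
  fixes p :: "'a::comm_ring_1 poly"
  assumes "degree p \<le> n"
  shows "poly p x = (\<Sum>k\<le>n. coeff p k * x ^ k)"
  unfolding poly_altdef using assms
  by (intro sum.mono_neutral_left) (auto simp: coeff_eq_0)

lemma eval2_quadratic:
  fixes f :: "'a::comm_ring_1 poly poly"
  assumes f: "total_degree f \<le> 2"
  defines "e \<equiv> \<lambda>i j. coeff (coeff f j) i"
  shows "eval2 f (x, y) = e 0 0 + e 1 0 * x + e 0 1 * y + e 2 0 * x\<^sup>2 + e 1 1 * (x * y) + e 0 2 * y\<^sup>2"
proof -
  have e0: "e i j = 0" if "i + j > 2" for i j
    using coeff_le_total_degree[of f j i] f that unfolding e_def by fastforce
  have "degree (coeff f j) \<le> 2" for j
    using e0 unfolding e_def by (intro degree_le) auto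
  then have p: "poly (coeff f j) x = (\<Sum>i\<le>2. e i j * x ^ i)" for j
    unfolding e_def by (rule poly_eq_sum_atMost)
  have "degree f \<le> 2" using degree_le_total_degree[of f] f by simp
  then have "eval2 f (x, y) = (\<Sum>j\<le>2. poly (coeff f j) x * y ^ j)"
    by (simp add: eval2_def poly_eq_sum_atMost poly_sum)
  also have "\<dots> = (\<Sum>j\<le>2. \<Sum>i\<le>2. e i j * x ^ i * y ^ j)"
    by (simp add: p sum_distrib_right)
  also have "\<dots> = e 0 0 + e 1 0 * x + e 0 1 * y + e 2 0 * x\<^sup>2 + e 1 1 * (x * y) + e 0 2 * y\<^sup>2"
    by (simp add: numeral_2_eq_2 e0 algebra_simps)
  finally show ?thesis .
qed

lemma eval2_graph: "eval2 f (x, poly p x) = poly (poly f p) x"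
  by (induction f) simp_all

lemma eval2_vertical: "eval2 f (x, y) = poly (map_poly (\<lambda>q. poly q x) f) y"
  by (induction f) (simp_all add: map_poly_pCons)

lemma irreducible_eq_const_smult:
  fixes f l :: "'a::field poly poly"
  assumes f: "irreducible f" and dvd: "l dvd f" and nu: "\<not> is_unit l"
  shows "\<exists>c. f = smult [:c:] l"
proof -
  obtain k where k: "f = l * k" using dvd by (elim dvdE)
  then have "is_unit k" using irreducibleD[OF f k] nu by blast
  then obtain w where "k = [:w:]" "is_unit w" unfolding is_unit_poly_iff by blast
  moreover then obtain c where "w = [:c:]" unfolding is_unit_poly_iff by blast
  ultimately show ?thesis using k by auto
qed

text \<open>The linear equation of a line on which \<open>f\<close> vanishes divides \<open>f\<close>. A line that is not vertical is a
  graph \<open>y = p(x)\<close> with monic equation in \<open>y\<close>; for a vertical one, \<open>x - A1\<close> divides each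
  coefficient of \<open>f\<close>. In both cases \<open>f\<close> would be a constant multiple of the line, of degree one.\<close>

lemma irreducible_conic_contains_no_line:
  fixes f :: "'a::field_char_0 poly poly"
  assumes f: "irreducible f" "total_degree f = 2" and v: "(v1, v2) \<noteq> (0, 0)"
    and line: "\<And>m. eval2 f (A1 + m * v1, A2 + m * v2) = 0"
  shows False
proof -
  obtain i j where ij: "i + j = 2" "coeff (coeff f j) i \<noteq> 0"
    using total_degree_attained[of f] f(2) by auto
  then have cases: "(i = 2 \<and> j = 0) \<or> (i = 1 \<and> j = 1) \<or> (i = 0 \<and> j = 2)" by auto
  show False
  proof (cases "v1 = 0")
    case False
    define p where "p = [:A2 - v2 / v1 * A1, v2 / v1:]"
    have "eval2 f (x, poly p x) = 0" for x
      using line[of "(x - A1) / v1"] False by (simp add: p_def field_simps)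
    then have "\<forall>x. poly (poly f p) x = 0" by (simp add: eval2_graph)
    then have "poly f p = 0" unfolding poly_all_0_iff_0 .
    then have "[:- p, 1:] dvd f" by (simp add: poly_eq_0_iff_dvd)
    moreover have "\<not> is_unit [:- p, 1:]" by (simp add: is_unit_poly_iff)
    ultimately obtain c where "f = smult [:c:] [:- p, 1:]"
      using irreducible_eq_const_smult[OF f(1)] by blast
    then show False using ij(2) cases by (auto simp: p_def numeral_2_eq_2)
  next
    case True
    then have v2: "v2 \<noteq> 0" using v by simp
    have "eval2 f (A1, y) = 0" for y
      using line[of "(y - A2) / v2"] v2 True by simp
    then have "\<forall>y. poly (map_poly (\<lambda>q. poly q A1) f) y = 0" by (simp add: eval2_vertical)
    then have "map_poly (\<lambda>q. poly q A1) f = 0" unfolding poly_all_0_iff_0 .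
    then have "poly (coeff f n) A1 = 0" for n by (metis coeff_0 coeff_map_poly poly_0)
    then have "[:[:- A1, 1:]:] dvd f" unfolding const_poly_dvd_iff by (simp add: poly_eq_0_iff_dvd)
    moreover have "\<not> is_unit [:[:- A1, 1:]:]" by (simp add: is_unit_poly_iff)
    ultimately obtain c where "f = smult [:c:] [:[:- A1, 1:]:]"
      using irreducible_eq_const_smult[OF f(1)] by blast
    then show False using ij(2) cases by (auto simp: numeral_2_eq_2)
  qed
qed

section \<open>The conchoid from a focus on the conic\<close>

text \<open>The focus is \<open>(A1, A2)\<close>, and the vanishing of \<open>f\<close> there is the missing constant term of the
  expansion. The condition on common zeros says that no line through the focus lies on the conic.\<close>

locale focused_conic =
  fixes f :: "'a::{alg_closed_field, field_char_0} poly poly"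
    and A1 A2 d l1 l2 a b c \<iota> :: 'a
  assumes expansion: "eval2 f (A1 + m * x, A2 + m * y)
       = m * (l1 * x + l2 * y) + m\<^sup>2 * (a * x\<^sup>2 + b * (x * y) + c * y\<^sup>2)"
    and no_common_zero:
      "l1 * x + l2 * y = 0 \<Longrightarrow> a * x\<^sup>2 + b * (x * y) + c * y\<^sup>2 = 0 \<Longrightarrow> x = 0 \<and> y = 0"
    and d_nz: "d \<noteq> 0" and imag_unit: "\<iota>\<^sup>2 = - 1"
begin

definition "L x y = l1 * x + l2 * y"
definition "Q x y = a * x\<^sup>2 + b * (x * y) + c * y\<^sup>2"

text \<open>With the denominator \<open>W\<close> these are the coordinates \<open>(t + 1/t) / 2\<close> and \<open>(t - 1/t) / (2 \<iota>)\<close> of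
  a point of the unit circle, as \<open>1 / \<iota> = - \<iota>\<close>; the polynomials \<open>LV\<close> and \<open>QV\<close> are the two forms at
  the numerators. The factor \<open>LV\<close> of \<open>E\<close> excludes the directions tangent to the conic at the focus,
  along which the second intersection is the focus itself.\<close>

definition "V1 = ([:1, 0, 1:] :: 'a poly)"
definition "V2 = [:\<iota>, 0, - \<iota>:]"
definition "W = ([:0, 2:] :: 'a poly)"
definition "LV = smult l1 V1 + smult l2 V2"
definition "QV = smult a (V1\<^sup>2) + smult b (V1 * V2) + smult c (V2\<^sup>2)"
definition "D = W * QV"
definition "N1 = smult A1 D + (smult d QV - W * LV) * V1"
definition "N2 = smult A2 D + (smult d QV - W * LV) * V2"
definition "E = D * LV"

definition "u1 t = poly V1 t / poly W t"
definition "u2 t = poly V2 t / poly W t"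

text \<open>The second intersection of the conic with the line in direction \<open>(x, y)\<close> is the focus plus
  \<open>\<mu> x y\<close> times the direction.\<close>

definition "\<mu> x y = - L x y / Q x y"

lemma f_expansion: "eval2 f (A1 + m * x, A2 + m * y) = m * L x y + m\<^sup>2 * Q x y"
  unfolding L_def Q_def by (rule expansion)

lemma L_Q_scale: "L (m * x) (m * y) = m * L x y" "Q (m * x) (m * y) = m\<^sup>2 * Q x y"
  unfolding L_def Q_def by algebra+

lemma poly_LV: "poly LV t = L (poly V1 t) (poly V2 t)"
  by (simp add: LV_def L_def)

lemma poly_QV: "poly QV t = Q (poly V1 t) (poly V2 t)"
  by (simp add: QV_def Q_def)

lemma V_unit: "t \<noteq> 0 \<Longrightarrow> poly V1 t = 2 * t * u1 t" "t \<noteq> 0 \<Longrightarrow> poly V2 t = 2 * t * u2 t"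
  by (simp_all add: u1_def u2_def W_def)

lemma unit_norm: "t \<noteq> 0 \<Longrightarrow> (u1 t)\<^sup>2 + (u2 t)\<^sup>2 = 1"
proof -
  assume t: "t \<noteq> 0"
  have "(poly V1 t)\<^sup>2 + (poly V2 t)\<^sup>2 = (2 * t)\<^sup>2"
    using imag_unit by (simp add: V1_def V2_def) algebra
  then have "(2 * t)\<^sup>2 * ((u1 t)\<^sup>2 + (u2 t)\<^sup>2) = (2 * t)\<^sup>2 * 1"
    unfolding V_unit[OF t] by algebra
  then show ?thesis using t by (subst (asm) mult_left_cancel) simp_all
qed

text \<open>The circle is the hyperbola \<open>(x + \<iota> y) (x - \<iota> y) = 1\<close>, so \<open>x + \<iota> y\<close> serves as the parameter.\<close>

lemma unit_surj:
  assumes "x\<^sup>2 + y\<^sup>2 = 1"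
  obtains t where "t \<noteq> 0" "x = u1 t" "y = u2 t"
proof -
  define t where "t = x + \<iota> * y"
  have inv: "t * (x - \<iota> * y) = 1" unfolding t_def using assms imag_unit by algebra
  then have t: "t \<noteq> 0" by auto
  have "poly V1 t = 2 * t * x" using inv unfolding V1_def t_def by simp algebra
  moreover have "poly V2 t = 2 * t * y" using inv imag_unit unfolding V2_def t_def by simp algebra
  ultimately show ?thesis using t that[of t] by (simp add: V_unit)
qed

lemma poly_LV_QV_unit:
  assumes "t \<noteq> 0"
  shows "poly LV t = 2 * t * L (u1 t) (u2 t)" "poly QV t = (2 * t)\<^sup>2 * Q (u1 t) (u2 t)"
  unfolding poly_LV poly_QV V_unit[OF assms] L_Q_scale by (rule refl)+

text \<open>The parameters \<open>1\<close> and \<open>\<iota>\<close> give the two coordinate directions; together with \<open>0\<close>, which gives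
  the isotropic direction \<open>(1, \<iota>)\<close>, they detect all coefficients of the two forms.\<close>

lemma V_special:
  "poly V1 1 = 2" "poly V2 1 = 0" "poly V1 \<iota> = 0" "poly V2 \<iota> = 2 * \<iota>" "\<iota> \<noteq> 0"
proof -
  show "poly V1 1 = 2" "poly V2 1 = 0" by (simp_all add: V1_def V2_def)
  show "poly V1 \<iota> = 0" "poly V2 \<iota> = 2 * \<iota>"
    using imag_unit by (simp_all add: V1_def V2_def power2_eq_square)
  show "\<iota> \<noteq> 0" using imag_unit by auto
qed

lemma LV_nz: "LV \<noteq> 0"
proof
  assume "LV = 0"
  then have "L (poly V1 t) (poly V2 t) = 0" for t by (simp flip: poly_LV)
  from this[of 1] this[of \<iota>] have "l1 * 2 = 0" "l2 * (2 * \<iota>) = 0"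
    unfolding L_def V_special by simp_all
  then have "l1 = 0" "l2 = 0" using V_special(5) by simp_all
  \<comment> \<open>A quadratic form over an algebraically closed field has a nontrivial zero.\<close>
  moreover have "a \<noteq> 0" using no_common_zero[of 1 0] \<open>l1 = 0\<close> by auto
  then obtain x where "poly [:c, b, a:] x = 0"
    using alg_closed_imp_poly_has_root[of "[:c, b, a:]"] by auto
  ultimately show False
    using no_common_zero[of x 1] by (auto simp: algebra_simps power2_eq_square)
qed

lemma QV_nz: "QV \<noteq> 0"
proof
  assume "QV = 0"
  then have "Q (poly V1 t) (poly V2 t) = 0" for t by (simp flip: poly_QV)
  from this[of 1] this[of \<iota>] this[of 0]
  have "a * 2\<^sup>2 = 0" "c * (2 * \<iota>)\<^sup>2 = 0" "a + b * \<iota> + c * \<iota>\<^sup>2 = 0"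
    unfolding Q_def V_special by (simp_all add: V1_def V2_def)
  then have "a = 0" "c = 0" "b = 0" using V_special(5) by auto
  \<comment> \<open>Now every zero of the linear form is common; \<open>(- l2, l1)\<close> is one, and if it is zero then so is the form.\<close>
  then show False
    using no_common_zero[of "- l2" l1] no_common_zero[of 1 0] by auto
qed

lemma E_nz: "E \<noteq> 0"
  using LV_nz QV_nz by (simp add: E_def D_def W_def)

lemma poly_E_nz_iff:
  "poly E t \<noteq> 0 \<longleftrightarrow> t \<noteq> 0 \<and> L (u1 t) (u2 t) \<noteq> 0 \<and> Q (u1 t) (u2 t) \<noteq> 0"
proof (cases "t = 0")
  case False
  then show ?thesis
    by (auto simp: E_def D_def poly_LV_QV_unit W_def)
qed (simp add: E_def D_def W_def)

lemma ratpoint_eq: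
  assumes "t \<noteq> 0" "Q (u1 t) (u2 t) \<noteq> 0"
  shows "ratpoint N1 N2 D t = (A1 + (d + \<mu> (u1 t) (u2 t)) * u1 t, A2 + (d + \<mu> (u1 t) (u2 t)) * u2 t)"
  using assms
  by (simp add: ratpoint_def N1_def N2_def D_def poly_LV_QV_unit V_unit \<mu>_def W_def
      field_simps power2_eq_square)

text \<open>If \<open>x\<close> lies at distance \<open>d\<close> from a point \<open>y\<close> of the conic, on the line from the focus to \<open>y\<close>, then
  \<open>v = (x - y) / d\<close> is a unit vector along this line. Orienting the line by \<open>x - y\<close> in this way absorbs
  the sign of the distance.\<close>

lemma conchoid_points:
  "{x. \<exists>y l. y \<in> zero_set f \<and> sq_norm (x - y) = d\<^sup>2 \<and>
     x = (A1 + l * (fst y - A1), A2 + l * (snd y - A2))}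
   = {ratpoint N1 N2 D t |t. poly E t \<noteq> 0}" (is "?S = ?R")
proof (intro equalityI subsetI)
  fix p assume "p \<in> ?S"
  then obtain y1 y2 l where y: "eval2 f (y1, y2) = 0" and n: "sq_norm (p - (y1, y2)) = d\<^sup>2"
    and p: "p = (A1 + l * (y1 - A1), A2 + l * (y2 - A2))"
    unfolding zero_set_def by auto
  \<comment> \<open>The unit vector is \<open>k\<close> times the vector from the focus to \<open>y\<close>.\<close>
  define w1 w2 k where "w1 = y1 - A1" and "w2 = y2 - A2" and "k = (l - 1) / d"
  have "(l - 1)\<^sup>2 * (w1\<^sup>2 + w2\<^sup>2) = d\<^sup>2"
    using n unfolding p w1_def w2_def sq_norm_def fst_diff snd_diff fst_conv snd_conv by algebra
  then have "k\<^sup>2 * (w1\<^sup>2 + w2\<^sup>2) = 1"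
    using d_nz by (simp add: k_def power_divide)
  then have unit: "(k * w1)\<^sup>2 + (k * w2)\<^sup>2 = 1" by algebra
  then have k: "k \<noteq> 0" by auto
  obtain t where t: "t \<noteq> 0" "k * w1 = u1 t" "k * w2 = u2 t" using unit_surj[OF unit] by blast
  have w: "w1 = inverse k * u1 t" "w2 = inverse k * u2 t" using k by (simp_all flip: t(2,3))
  have "eval2 f (A1 + inverse k * u1 t, A2 + inverse k * u2 t) = 0"
    using y by (simp flip: w add: w1_def w2_def)
  then have "inverse k * (L (u1 t) (u2 t) + inverse k * Q (u1 t) (u2 t)) = 0"
    unfolding f_expansion by (simp add: algebra_simps power2_eq_square)
  then have LQ: "L (u1 t) (u2 t) + inverse k * Q (u1 t) (u2 t) = 0" using k by simp
  have "Q (u1 t) (u2 t) \<noteq> 0"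
  proof
    assume "Q (u1 t) (u2 t) = 0"
    moreover then have "L (u1 t) (u2 t) = 0" using LQ by simp
    ultimately have "u1 t = 0 \<and> u2 t = 0" unfolding L_def Q_def by (intro no_common_zero)
    then show False using unit t(2,3) by simp
  qed
  moreover have "L (u1 t) (u2 t) \<noteq> 0" using LQ k calculation by auto
  moreover have \<mu>: "\<mu> (u1 t) (u2 t) = inverse k"
    using LQ calculation by (simp add: \<mu>_def field_simps add_eq_0_iff)
  have "l * w1 = (d + inverse k) * u1 t" "l * w2 = (d + inverse k) * u2 t"
    using k d_nz unfolding t(2,3)[symmetric] by (simp_all add: k_def field_simps)
  then have "p = (A1 + (d + \<mu> (u1 t) (u2 t)) * u1 t, A2 + (d + \<mu> (u1 t) (u2 t)) * u2 t)"
    unfolding p \<mu> w1_def w2_def by simp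
  ultimately have "poly E t \<noteq> 0" "p = ratpoint N1 N2 D t"
    using t(1) by (simp_all add: ratpoint_eq poly_E_nz_iff)
  then show "p \<in> ?R" by blast
next
  fix p assume "p \<in> ?R"
  then obtain t where t: "p = ratpoint N1 N2 D t" "t \<noteq> 0" "L (u1 t) (u2 t) \<noteq> 0" "Q (u1 t) (u2 t) \<noteq> 0"
    using poly_E_nz_iff by auto
  define m where "m = \<mu> (u1 t) (u2 t)"
  have m: "m \<noteq> 0" using t by (simp add: m_def \<mu>_def)
  have LQ: "L (u1 t) (u2 t) + m * Q (u1 t) (u2 t) = 0" using t by (simp add: m_def \<mu>_def)
  have p: "p = (A1 + (d + m) * u1 t, A2 + (d + m) * u2 t)"
    unfolding t(1) m_def using t by (simp add: ratpoint_eq)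
  have "eval2 f (A1 + m * u1 t, A2 + m * u2 t) = 0"
    unfolding f_expansion using LQ by algebra
  moreover have "sq_norm (p - (A1 + m * u1 t, A2 + m * u2 t)) = d\<^sup>2"
    using unit_norm[OF t(2)] unfolding p sq_norm_def fst_diff snd_diff fst_conv snd_conv by algebra
  ultimately show "p \<in> ?S"
    using p m unfolding zero_set_def
    by (intro CollectI exI[of _ "(A1 + m * u1 t, A2 + m * u2 t)"] exI[of _ "(d + m) / m"]) auto
qed

text \<open>Replacing \<open>t\<close> by \<open>- t\<close> reverses the unit vector, keeps the point of the conic and moves to the
  other point at distance \<open>d\<close>. A constant first coordinate would make the two points agree there,
  but they differ by \<open>2 d\<close> times the first coordinate of the unit vector.\<close>

lemma N1_nonconstant: "N1 \<noteq> smult k D"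
proof
  assume N1: "N1 = smult k D"
  have "V1 \<noteq> 0" by (simp add: V1_def)
  then have "E * V1 \<noteq> 0" using E_nz by (metis mult_eq_0_iff)
  then obtain t where t: "poly (E * V1) t \<noteq> 0"
    using infinite_imp_nonempty[OF infinite_nonroots] by blast
  have even: "poly V1 (- t) = poly V1 t" "poly V2 (- t) = poly V2 t"
    by (simp_all add: V1_def V2_def)
  have odd: "poly W (- t) = - poly W t" by (simp add: W_def)
  have "poly N1 t = k * poly D t" "poly N1 (- t) = k * poly D (- t)" using N1 by simp_all
  then have "2 * d * poly QV t * poly V1 t = 0"
    unfolding N1_def D_def
    by (simp add: even odd poly_LV poly_QV) algebra
  then show False using t d_nz by (simp add: E_def D_def)
qed

sublocale rational_parametrization N1 N2 D E
  by unfold_locales (use E_nz N1_nonconstant in \<open>simp_all add: E_def\<close>)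

text \<open>With \<open>x - A = s v\<close> for a unit vector \<open>v\<close> and \<open>s = d - L v / Q v\<close>, the equation of the conic becomes
  \<open>f x = s (L v + s Q v) = s d Q v\<close>. Squaring and using that \<open>s\<^sup>2\<close> is the squared norm of \<open>x - A\<close>
  eliminates \<open>v\<close> and \<open>s\<close>.\<close>

definition "X = ([:[:- A1, 1:]:] :: 'a poly poly)"
definition "Y = ([:[:- A2:], 1:] :: 'a poly poly)"
definition "G = (X\<^sup>2 + Y\<^sup>2) * f\<^sup>2
  - smult [:d\<^sup>2:] ((smult [:a:] (X\<^sup>2) + smult [:b:] (X * Y) + smult [:c:] (Y\<^sup>2))\<^sup>2)"

lemma eval2_G:
  "eval2 G (A1 + s * x, A2 + s * y)
    = s ^ 4 * ((x\<^sup>2 + y\<^sup>2) * (L x y + s * Q x y)\<^sup>2 - d\<^sup>2 * (Q x y)\<^sup>2)"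
proof -
  have X: "eval2 X (A1 + s * x, A2 + s * y) = s * x" by (simp add: X_def)
  have Y: "eval2 Y (A1 + s * x, A2 + s * y) = s * y" by (simp add: Y_def)
  show ?thesis
    unfolding G_def eval2_simps X Y f_expansion by (simp add: Q_def) algebra
qed

lemma vanishes_G: "vanishes G"
  unfolding vanishes_def
proof (intro allI impI)
  fix t assume "poly E t \<noteq> 0"
  then have t: "t \<noteq> 0" "Q (u1 t) (u2 t) \<noteq> 0" by (auto simp: poly_E_nz_iff)
  have "L (u1 t) (u2 t) + (d + \<mu> (u1 t) (u2 t)) * Q (u1 t) (u2 t) = d * Q (u1 t) (u2 t)"
    using t by (simp add: \<mu>_def field_simps)
  then show "eval2 G (ratpoint N1 N2 D t) = 0"
    unfolding ratpoint_eq[OF t] eval2_G by (simp add: unit_norm[OF t(1)] power_mult_distrib)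
qed

text \<open>On the line through the focus along a unit vector \<open>v\<close> with \<open>Q v \<noteq> 0\<close>, the relation vanishes only
  at the focus and at the two points that lie \<open>d\<close> and \<open>- d\<close> along \<open>v\<close> from the second intersection with
  the conic. The points \<open>2 d\<close> and \<open>3 d\<close> along \<open>v\<close> differ from those two, and at most one of them is
  the focus.\<close>

lemma G_nz: "G \<noteq> 0"
proof
  assume "G = 0"
  obtain t where "poly E t \<noteq> 0"
    using infinite_imp_nonempty[OF infinite_nonroots[OF E_nz]] by blast
  then have t: "t \<noteq> 0" "Q (u1 t) (u2 t) \<noteq> 0" by (auto simp: poly_E_nz_iff)
  define m where "m = \<mu> (u1 t) (u2 t)"
  have "m + n * d = 0" if "n = 2 \<or> n = 3" for n
  proof -
    have "L (u1 t) (u2 t) + (m + n * d) * Q (u1 t) (u2 t) = n * (d * Q (u1 t) (u2 t))"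
      using t by (simp add: m_def \<mu>_def field_simps)
    then have "eval2 G (A1 + (m + n * d) * u1 t, A2 + (m + n * d) * u2 t)
      = (m + n * d) ^ 4 * ((n\<^sup>2 - 1) * (d\<^sup>2 * (Q (u1 t) (u2 t))\<^sup>2))"
      unfolding eval2_G unit_norm[OF t(1)] by algebra
    then show ?thesis using \<open>G = 0\<close> d_nz t that by auto
  qed
  then have "m + 2 * d = 0" "m + 3 * d = 0" by blast+
  then have "d = 0" by algebra
  then show False using d_nz by simp
qed

lemma rational_curve_conchoid: "rational_curve (conchoid (zero_set f) (A1, A2) d)"
  unfolding conchoid_def fst_conv snd_conv conchoid_points
  using G_nz vanishes_G by (rule rational_curve_closure)

end

text \<open>Taylor expansion at a point of the conic: the linear form \<open>(l1, l2)\<close> is the gradient there,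
  and a common zero of both forms would span a line inside the conic.\<close>

lemma irreducible_conic_focused:
  fixes f :: "'a::{alg_closed_field, field_char_0} poly poly"
  assumes f: "irreducible f" "total_degree f = 2" and A: "eval2 f (A1, A2) = 0" and d: "d \<noteq> 0"
  shows "\<exists>l1 l2 a b c \<iota>. focused_conic f A1 A2 d l1 l2 a b c \<iota>"
proof -
  define e where "e = (\<lambda>i j. coeff (coeff f j) i)"
  define l1 where "l1 = e 1 0 + 2 * e 2 0 * A1 + e 1 1 * A2"
  define l2 where "l2 = e 0 1 + e 1 1 * A1 + 2 * e 0 2 * A2"
  have q: "eval2 f (x, y) = e 0 0 + e 1 0 * x + e 0 1 * y
      + e 2 0 * x\<^sup>2 + e 1 1 * (x * y) + e 0 2 * y\<^sup>2" for x y
    unfolding e_def using f(2) by (intro eval2_quadratic) simp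
  have expansion: "eval2 f (A1 + m * x, A2 + m * y)
       = m * (l1 * x + l2 * y) + m\<^sup>2 * (e 2 0 * x\<^sup>2 + e 1 1 * (x * y) + e 0 2 * y\<^sup>2)" for m x y
    using A unfolding q l1_def l2_def by algebra
  have no_common_zero: "x = 0 \<and> y = 0"
    if "l1 * x + l2 * y = 0" "e 2 0 * x\<^sup>2 + e 1 1 * (x * y) + e 0 2 * y\<^sup>2 = 0" for x y
  proof -
    have "eval2 f (A1 + m * x, A2 + m * y) = 0" for m unfolding expansion that by simp
    then show ?thesis using irreducible_conic_contains_no_line[OF f, of x y A1 A2] by auto
  qed
  obtain \<iota> :: 'a where "\<iota>\<^sup>2 = - 1" using nth_root_exists[of 2 "- 1 :: 'a"] by auto
  then have "focused_conic f A1 A2 d l1 l2 (e 2 0) (e 1 1) (e 0 2) \<iota>"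
    using expansion no_common_zero d by (intro focused_conic.intro)
  then show ?thesis by blast
qed

theorem corollary3p15:
  fixes C :: "('a::{alg_closed_field, field_char_0} \<times> 'a) set"
    and A :: "'a \<times> 'a" and d :: 'a
  assumes "irreducible_conic C" and "A \<in> C" and "d \<noteq> 0"
  shows "rational_curve (conchoid C A d)"
proof -
  obtain f where f: "irreducible f" "total_degree f = 2" and C: "C = zero_set f"
    using assms(1) unfolding irreducible_conic_def by blast
  obtain A1 A2 where A: "A = (A1, A2)" by fastforce
  have "eval2 f (A1, A2) = 0" using assms(2) unfolding A C zero_set_def by simp
  then obtain l1 l2 a b c \<iota> where "focused_conic f A1 A2 d l1 l2 a b c \<iota>"
    using irreducible_conic_focused[OF f _ assms(3)] by blast
  then show ?thesis unfolding A C by (rule focused_conic.rational_curve_conchoid)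
qed

end
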